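(* Let $p$ be a prime, let $a$ be a positive integer, and let $d\in\{0,1,\ldots,p^a\}$. For $e\in\{0,1,\ldots,p^a\}$ set $$S_e=\sum_{0<k<e}\frac{(-1)^{k-1}}{k}\left(\frac{e-k}{3}\right)$$ and $$F(e)=\frac12\left(\sum_{k=0}^{p^a-1}\binom{2k}{k+e}-\left(\frac{p^a-e}{3}\right)\right)+(-1)^{p}p^aS_e-p\,[p=3]\left(\frac{e}{3}\right).$$ Then $$F(d)\equiv p\,[p=2\ \text{and}\ 3\nmid (-1)^a+d]\pmod{p^2}$$ and $$F(p^a-d)\equiv F(d)\pmod{p^3}.$$
   Context: For an integer $x$, $\left(\frac{x}{3}\right)\in\{0,1,-1\}$ denotes the Legendre symbol modulo 3, i.e. the unique element of $\{0,\pm1\}$ congruent to $x$ modulo 3. For an assertion $A$, $[A]$ equals $1$ if $A$ holds and $0$ otherwise (Iverson bracket). $\binom{n}{k}=0$ if $k>n$ or $k<0$. For rational numbers $x,y$ and a prime power $p^m$, $x\equiv y\pmod{p^m}$ means that $(x-y)/p^m$ is a rational number whose denominator (in lowest terms) is not divisible by $p$. *)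

theory Defs
  imports "HOL-Number_Theory.Number_Theory"
begin

definition rat_cong :: "nat \<Rightarrow> nat \<Rightarrow> rat \<Rightarrow> rat \<Rightarrow> bool" where
  "rat_cong p m x y \<longleftrightarrow> \<not> int p dvd snd (quotient_of ((x - y) / of_nat p ^ m))"

definition S :: "nat \<Rightarrow> rat" where
  "S e = (\<Sum>k\<in>{0<..<e}. (- 1) ^ (k - 1) / of_nat k * of_int (Legendre (int e - int k) 3))"

definition F :: "nat \<Rightarrow> nat \<Rightarrow> nat \<Rightarrow> rat" where
  "F p a e =
     1 / 2 * ((\<Sum>k = 0..p ^ a - 1. of_nat ((2 * k) choose (k + e)))
              - of_int (Legendre (int (p ^ a) - int e) 3))
     + (- 1) ^ p * of_nat (p ^ a) * S e
     - of_nat p * of_bool (p = 3) * of_int (Legendre (int e) 3)"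

end

theory Submission
  imports Defs
begin

text \<open>
  Write \<open>q = p^a\<close> and \<open>\<chi> = (\<cdot>/3)\<close>. Any three consecutive values of \<open>\<chi>\<close> sum to zero. This has two
  exact consequences: \<open>\<Sum>k<q. C(2k,k+d) = \<chi>(q-d) + 2 D(q-d)\<close> with
  \<open>D(e) = 1/2 \<Sum>0<k<e. C(2q,k) \<chi>(e-k)\<close>; and, for \<open>B(e) = \<Sum>0<k<e. C(q,k) \<chi>(e-k)\<close>,
  the difference \<open>B(d) - B(q-d)\<close> is a combination of three values of \<open>\<chi>\<close>. On the other hand,
  expanding \<open>C(n,k) = n/k (-1)^(k-1) (\<Prod>0<j<k. 1 - n/j)\<close> for \<open>n = q\<close> and \<open>n = 2q\<close> gives
  \<open>D(e) \<equiv> q S\<^sub>e \<equiv> B(e)\<close> modulo \<open>p^2\<close>, \<open>D(e) + q S\<^sub>e \<equiv> 2 B(e)\<close> modulo \<open>p^3\<close>, and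
  \<open>D(e) \<equiv> q S\<^sub>e\<close> modulo \<open>2 p^2\<close>, which is \<open>p^3\<close> when \<open>p = 2\<close>. So both congruences reduce to the
  exact value of \<open>B(d) - B(q-d)\<close>.
\<close>

section \<open>The Legendre symbol modulo 3\<close>

lemma Legendre_3: "Legendre x 3 = (if x mod 3 = 0 then 0 else if x mod 3 = 1 then 1 else - 1)"
proof -
  have "QuadRes 3 x \<longleftrightarrow> x mod 3 \<noteq> 2"
  proof
    assume "QuadRes 3 x"
    then obtain y where y: "x mod 3 = y\<^sup>2 mod 3"
      unfolding QuadRes_def cong_def by metis
    have "y\<^sup>2 mod 3 = (y mod 3)\<^sup>2 mod 3"
      by (simp add: power_mod)
    moreover have "y mod 3 = 0 \<or> y mod 3 = 1 \<or> y mod 3 = 2"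
      by presburger
    ultimately show "x mod 3 \<noteq> 2"
      unfolding y by auto
  next
    assume "x mod 3 \<noteq> 2"
    then have "(x mod 3)\<^sup>2 mod 3 = x mod 3"
      using pos_mod_bound[of 3 x] pos_mod_sign[of 3 x]
      by (cases "x mod 3 = 0"; cases "x mod 3 = 1") auto
    then show "QuadRes 3 x"
      unfolding QuadRes_def cong_def by blast
  qed
  then show ?thesis
    by (auto simp: Legendre_def cong_def)
qed

lemma Legendre_3_uminus: "Legendre (- x) 3 = - Legendre x 3"
proof -
  have "x mod 3 = 0 \<and> (- x) mod 3 = 0 \<or> x mod 3 = 1 \<and> (- x) mod 3 = 2
      \<or> x mod 3 = 2 \<and> (- x) mod 3 = 1"
    by presburger
  then show ?thesis
    by (auto simp: Legendre_3)
qed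

lemma Legendre_3_cong: "x mod 3 = y mod 3 \<Longrightarrow> Legendre x 3 = Legendre y 3"
  by (simp add: Legendre_3)

text \<open>The three arguments represent every residue class modulo 3 once, and the symbols of the
  classes are 0, 1, -1. The case q = 1 gives the three-term recurrence; a prime power q occurs in
  the final evaluation.\<close>

lemma Legendre_3_add_residues:
  assumes "\<not> 3 dvd q"
  shows "Legendre (x + q) 3 + Legendre x 3 + Legendre (x - q) 3 = 0"
proof -
  have "x mod 3 = 0 \<or> x mod 3 = 1 \<or> x mod 3 = 2" "q mod 3 = 1 \<or> q mod 3 = 2"
    using assms by presburger+
  moreover have "(x + q) mod 3 = (x mod 3 + q mod 3) mod 3" "(x - q) mod 3 = (x mod 3 - q mod 3) mod 3"
    by (simp_all add: mod_simps)
  ultimately show ?thesis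
    by (elim disjE) (simp_all add: Legendre_3)
qed

lemma Legendre_3_pred: "Legendre (x - 1) 3 = - Legendre x 3 - Legendre (x + 1) 3"
  using Legendre_3_add_residues[of 1 x] by simp

section \<open>Exact identities for binomial sums weighted by the symbol modulo 3\<close>

text \<open>Pascal's rule splits row n + 1 at x into row n at x and row n at x - 1, and adding the
  symbols at y and y - 1 gives minus the symbol at y + 1.\<close>

lemma sum_binomial_Legendre_3:
  "(\<Sum>k\<le>n. int (n choose k) * Legendre (x - int k) 3) = (- 1) ^ n * Legendre (x + int n) 3"
proof (induction n arbitrary: x)
  case (Suc n)
  let ?f = "\<lambda>n x k. int (n choose k) * Legendre (x - int k) 3"
  have "(\<Sum>k\<le>Suc n. ?f (Suc n) x k) = ?f (Suc n) x 0 + (\<Sum>k\<le>n. ?f (Suc n) x (Suc k))"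
    by (rule sum.atMost_Suc_shift)
  also have "\<dots> = ?f n x 0 + (\<Sum>k\<le>n. ?f n x (Suc k)) + (\<Sum>k\<le>n. ?f n (x - 1) k)"
    by (simp add: algebra_simps sum.distrib)
  also have "?f n x 0 + (\<Sum>k\<le>n. ?f n x (Suc k)) = (\<Sum>k\<le>Suc n. ?f n x k)"
    by (rule sum.atMost_Suc_shift[symmetric])
  also have "\<dots> = (\<Sum>k\<le>n. ?f n x k)"
    by simp
  also have "\<dots> + (\<Sum>k\<le>n. ?f n (x - 1) k)
      = (- 1) ^ n * (Legendre (x + int n) 3 + Legendre (x + int n - 1) 3)"
    by (simp only: Suc.IH) (simp add: algebra_simps)
  also have "\<dots> = (- 1) ^ Suc n * Legendre (x + int (Suc n)) 3"
    by (simp add: Legendre_3_pred algebra_simps)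
  finally show ?case .
qed simp

text \<open>Summation by parts: an interior \<open>b j\<close> is multiplied by three consecutive
  symbols, hence by zero, so only boundary terms survive.\<close>

lemma sum_three_term_Legendre_3:
  fixes b :: "nat \<Rightarrow> int"
  shows "(\<Sum>m<N. (b m + b (Suc m) + b (Suc (Suc m))) * Legendre (int (Suc m)) 3)
    = b 0 - b N * Legendre (int (Suc N)) 3 + b (Suc N) * Legendre (int N) 3"
proof (induction N)
  case (Suc N)
  have *: "Legendre (int (Suc (Suc N))) 3 = - Legendre (int N) 3 - Legendre (int (Suc N)) 3"
    using Legendre_3_pred[of "int (Suc N)"] by simp
  show ?case
    unfolding sum.lessThan_Suc Suc.IH * by (simp only: algebra_simps)
qed (simp add: Legendre_3)

text \<open>Two applications of Pascal's rule write each entry of row 2n + 2 as a three-term block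
  plus the matching entry of row 2n. The blocks collapse to \<open>b 0\<close>, the new central
  summand. The bound N is kept apart from n so that it stays fixed in the induction; n < N kills the
  upper boundary terms.\<close>

lemma sum_central_binomial_shift:
  assumes "n \<le> N"
  shows "(\<Sum>k<n. int ((2 * k) choose (k + d)))
    = (\<Sum>m<N. int ((2 * n) choose (n + d + Suc m)) * Legendre (int (Suc m)) 3)"
  using assms
proof (induction n)
  case (Suc n)
  define b where "b m = int ((2 * n) choose (n + d + m))" for m
  have "b N = 0" "b (Suc N) = 0"
    using Suc.prems by (auto simp: b_def intro: binomial_eq_0)
  have pascal: "int ((2 * Suc n) choose (Suc n + d + Suc m))
      = b m + b (Suc m) + b (Suc (Suc m)) + b (Suc m)" for m
    by (simp add: b_def)
  have "(\<Sum>m<N. int ((2 * Suc n) choose (Suc n + d + Suc m)) * Legendre (int (Suc m)) 3)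
     = (\<Sum>m<N. (b m + b (Suc m) + b (Suc (Suc m))) * Legendre (int (Suc m)) 3)
       + (\<Sum>m<N. b (Suc m) * Legendre (int (Suc m)) 3)"
    unfolding pascal sum.distrib[symmetric] by (simp only: distrib_right)
  also have "\<dots> = b 0 + (\<Sum>k<n. int ((2 * k) choose (k + d)))"
    unfolding sum_three_term_Legendre_3 \<open>b N = 0\<close> \<open>b (Suc N) = 0\<close>
    using Suc by (simp add: b_def)
  finally show ?case
    by (simp add: b_def)
qed simp

text \<open>Common shape of D, B and q times \<open>S\<close>. It is linear in the weight
  \<open>f\<close>, so congruences between weights pass to the sums term by term.\<close>

definition wsum :: "(nat \<Rightarrow> rat) \<Rightarrow> nat \<Rightarrow> rat" where
  "wsum f e = (\<Sum>k\<in>{0<..<e}. f k * of_int (Legendre (int e - int k) 3))"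

lemma wsum_add: "wsum (\<lambda>k. f k + g k) e = wsum f e + wsum g e"
  by (simp add: wsum_def distrib_right sum.distrib)

lemma wsum_diff: "wsum (\<lambda>k. f k - g k) e = wsum f e - wsum g e"
  by (simp add: wsum_def left_diff_distrib sum_subtractf)

lemma wsum_mult_left: "wsum (\<lambda>k. c * f k) e = c * wsum f e"
  by (simp add: wsum_def sum_distrib_left mult.assoc)

text \<open>Reflecting row 2n and substituting k = n - d - (m + 1) turns the shifted sum into a
  \<open>wsum\<close>; its extra term k = 0 is the isolated symbol, which \<open>F\<close>
  subtracts.\<close>

lemma sum_central_binomial_eq_wsum:
  assumes "d \<le> n"
  shows "(\<Sum>k<n. of_nat ((2 * k) choose (k + d)))
    = of_int (Legendre (int n - int d) 3) + wsum (\<lambda>k. of_nat ((2 * n) choose k)) (n - d)"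
proof -
  let ?e = "n - d"
  let ?g = "\<lambda>k. int ((2 * n) choose k) * Legendre (int ?e - int k) 3"
  have "(\<Sum>k<n. int ((2 * k) choose (k + d)))
      = (\<Sum>m<n. int ((2 * n) choose (n + d + Suc m)) * Legendre (int (Suc m)) 3)"
    by (rule sum_central_binomial_shift) simp
  \<comment> \<open>For m \<ge> n - d the lower index exceeds 2n, so the binomial coefficient
    vanishes.\<close>
  also have "\<dots> = (\<Sum>m<?e. int ((2 * n) choose (n + d + Suc m)) * Legendre (int (Suc m)) 3)"
    using assms by (intro sum.mono_neutral_right) auto
  also have "\<dots> = (\<Sum>m<?e. ?g (?e - Suc m))"
  proof (rule sum.cong)
    fix m assume "m \<in> {..<?e}"
    then have "2 * n - (?e - Suc m) = n + d + Suc m" "?e - Suc m \<le> 2 * n"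
      "int ?e - int (?e - Suc m) = int (Suc m)"
      using assms by auto
    then show "int ((2 * n) choose (n + d + Suc m)) * Legendre (int (Suc m)) 3 = ?g (?e - Suc m)"
      by (metis binomial_symmetric)
  qed simp
  also have "\<dots> = (\<Sum>k<?e. ?g k)"
    by (rule sum.nat_diff_reindex)
  also have "\<dots> = Legendre (int ?e) 3 + (\<Sum>k\<in>{0<..<?e}. ?g k)"
  proof (cases ?e)
    case (Suc e)
    have "{..<?e} = insert 0 {0<..<?e}"
      using Suc by auto
    then show ?thesis
      by simp
  qed (simp add: Legendre_3)
  finally have "rat_of_int (\<Sum>k<n. int ((2 * k) choose (k + d)))
      = of_int (Legendre (int ?e) 3 + (\<Sum>k\<in>{0<..<?e}. ?g k))"
    by (rule arg_cong)
  then show ?thesis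
    using assms by (simp add: wsum_def of_nat_diff)
qed

text \<open>The symbol is odd, so k \<mapsto> q - k turns the second sum into minus the range d < k
  < q of the first. Since k = d contributes zero, the difference is the full row sum without its
  ends k = 0 and k = q.\<close>

lemma wsum_binomial_diff:
  assumes "d \<le> q" "0 < q"
  shows "wsum (\<lambda>k. of_nat (q choose k)) d - wsum (\<lambda>k. of_nat (q choose k)) (q - d)
    = of_int ((- 1) ^ q * Legendre (int d + int q) 3 - Legendre (int d) 3
        - Legendre (int d - int q) 3)"
proof -
  let ?g = "\<lambda>x k. int (q choose k) * Legendre (x - int k) 3"
  have "(\<Sum>k\<in>{0<..<q - d}. ?g (int (q - d)) k) = (\<Sum>k\<in>{d<..<q}. - ?g (int d) k)"
  proof (rule sum.reindex_bij_witness[of _ "\<lambda>k. q - k" "\<lambda>k. q - k"])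
    fix k assume "k \<in> {0<..<q - d}"
    then have "int d - int (q - k) = - (int (q - d) - int k)" "q choose k = q choose (q - k)"
      by (auto intro: binomial_symmetric)
    then show "- ?g (int d) (q - k) = ?g (int (q - d)) k"
      by (simp only: Legendre_3_uminus)
  qed auto
  then have "(\<Sum>k\<in>{0<..<d}. ?g (int d) k) - (\<Sum>k\<in>{0<..<q - d}. ?g (int (q - d)) k)
      = (\<Sum>k\<in>{0<..<d}. ?g (int d) k) + (\<Sum>k\<in>{d<..<q}. ?g (int d) k)"
    by (simp add: sum_negf)
  also have "\<dots> = (\<Sum>k\<in>{0<..<d} \<union> {d<..<q}. ?g (int d) k)"
    by (rule sum.union_disjoint[symmetric]) auto
  also have "\<dots> = (\<Sum>k\<in>{0<..<q}. ?g (int d) k)"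
    using assms by (intro sum.mono_neutral_left) (auto simp: Legendre_3)
  also have "\<dots> = (\<Sum>k\<le>q. ?g (int d) k) - Legendre (int d) 3 - Legendre (int d - int q) 3"
  proof -
    have "{..q} = insert 0 (insert q {0<..<q})"
      using assms by auto
    then show ?thesis
      using assms by simp
  qed
  finally have "rat_of_int ((\<Sum>k\<in>{0<..<d}. ?g (int d) k) - (\<Sum>k\<in>{0<..<q - d}. ?g (int (q - d)) k))
      = of_int ((- 1) ^ q * Legendre (int d + int q) 3 - Legendre (int d) 3
        - Legendre (int d - int q) 3)"
    by (simp only: sum_binomial_Legendre_3)
  then show ?thesis
    by (simp add: wsum_def)
qed

section \<open>Product expansion of binomial coefficients\<close>

text \<open>Each factor (n - j)/j equals -(1 - n/j). For n = q and n = 2q this isolates the leading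
  term, the remaining factors being close to 1 p-adically.\<close>

lemma of_nat_choose_eq_prod:
  assumes "0 < k"
  shows "(of_nat (n choose k) :: rat)
    = of_nat n * ((- 1) ^ (k - 1) / of_nat k) * (\<Prod>j\<in>{0<..<k}. 1 - of_nat n / of_nat j)"
  using assms
proof (induction k rule: nat_induct_non_zero)
  case 1
  show ?case by simp
next
  case (Suc k)
  define s where "s = (- 1 :: rat) ^ (k - 1)"
  define Q where "Q = (\<Prod>j\<in>{0<..<k}. 1 - rat_of_nat n / of_nat j)"
  have *: "1 - rat_of_nat n / of_nat k = - ((of_nat n - of_nat k) / of_nat k)"
    using Suc.hyps by (simp add: field_simps)
  have "(of_nat (n choose Suc k) :: rat) = of_nat (n choose k) * (of_nat n - of_nat k) / of_nat (Suc k)"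
    by (simp add: binomial_gbinomial gbinomial_prod_rev field_simps)
  also have "\<dots> = of_nat n * (- s / of_nat (Suc k)) * ((1 - of_nat n / of_nat k) * Q)"
    unfolding Suc.IH s_def[symmetric] Q_def[symmetric] * by (simp add: mult_ac)
  also have "- s = (- 1) ^ (Suc k - 1)"
    using Suc.hyps by (cases k) (auto simp: s_def)
  also have "(1 - of_nat n / of_nat k) * Q = (\<Prod>j\<in>{0<..<Suc k}. 1 - rat_of_nat n / of_nat j)"
  proof -
    have "{0<..<Suc k} = insert k {0<..<k}"
      using Suc.hyps by auto
    then show ?thesis
      by (simp add: Q_def)
  qed
  finally show ?case .
qed

section \<open>Arithmetic of p-integral rationals\<close>

text \<open>Membership in the localization of the integers at p; congruences become closure
  properties of this ring.\<close>

definition p_integral :: "nat \<Rightarrow> rat \<Rightarrow> bool" where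
  "p_integral p x \<longleftrightarrow> \<not> int p dvd snd (quotient_of x)"

lemma rat_cong_iff_p_integral: "rat_cong p m x y \<longleftrightarrow> p_integral p ((x - y) / of_nat p ^ m)"
  by (simp add: rat_cong_def p_integral_def)

text \<open>The reduced denominator divides every other denominator, so a fraction need not be in
  lowest terms to serve as a witness.\<close>

lemma p_integral_iff:
  "p_integral p x \<longleftrightarrow> (\<exists>m n. \<not> int p dvd n \<and> x = of_int m / of_int n)"
proof
  obtain m n where mn: "quotient_of x = (m, n)"
    by fastforce
  assume "p_integral p x"
  then show "\<exists>m n. \<not> int p dvd n \<and> x = of_int m / of_int n"
    using quotient_of_div[OF mn] mn by (auto simp: p_integral_def)
next
  obtain m n where mn: "quotient_of x = (m, n)"
    by fastforce
  assume "\<exists>m n. \<not> int p dvd n \<and> x = of_int m / of_int n"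
  then obtain m' n' where *: "\<not> int p dvd n'" "x = of_int m' / of_int n'"
    by blast
  have "n > 0" "coprime m n" "n' \<noteq> 0"
    using mn quotient_of_denom_pos quotient_of_coprime * by auto
  then have "rat_of_int (m * n') = of_int (m' * n)"
    using *(2) quotient_of_div[OF mn] by (simp add: field_simps)
  then have "n dvd m * n'"
    by (simp only: of_int_eq_iff) simp
  then have "n dvd n'"
    using \<open>coprime m n\<close> by (simp add: coprime_commute coprime_dvd_mult_right_iff)
  then show "p_integral p x"
    using *(1) mn by (auto simp: p_integral_def dest: dvd_trans)
qed

context
  fixes p :: nat
  assumes prime: "prime p"
begin

lemma p_integral_of_int [simp]: "p_integral p (of_int m)"
  unfolding p_integral_iff using prime
  by (intro exI[of _ m] exI[of _ 1]) (auto simp: not_prime_1)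

lemma p_integral_of_nat [simp]: "p_integral p (of_nat m)"
  using p_integral_of_int[of "int m"] by simp

lemma p_integral_0 [simp]: "p_integral p 0"
  and p_integral_1 [simp]: "p_integral p 1"
  and p_integral_numeral [simp]: "p_integral p (numeral w)"
  using p_integral_of_int[of 0] p_integral_of_int[of 1] p_integral_of_int[of "numeral w"] by simp_all

lemma p_integral_mult:
  assumes "p_integral p x" "p_integral p y"
  shows "p_integral p (x * y)"
proof -
  obtain m n k l where "\<not> int p dvd n" "x = of_int m / of_int n" "\<not> int p dvd l" "y = of_int k / of_int l"
    using assms by (auto simp: p_integral_iff)
  then show ?thesis
    unfolding p_integral_iff using prime
    by (intro exI[of _ "m * k"] exI[of _ "n * l"]) (auto simp: prime_dvd_mult_iff)
qed

lemma p_integral_add: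
  assumes "p_integral p x" "p_integral p y"
  shows "p_integral p (x + y)"
proof -
  obtain m n k l where *: "\<not> int p dvd n" "x = of_int m / of_int n" "\<not> int p dvd l" "y = of_int k / of_int l"
    using assms by (auto simp: p_integral_iff)
  then have "n \<noteq> 0" "l \<noteq> 0"
    by auto
  with * show ?thesis
    unfolding p_integral_iff using prime
    by (intro exI[of _ "m * l + k * n"] exI[of _ "n * l"])
      (auto simp: prime_dvd_mult_iff field_simps)
qed

lemma p_integral_uminus: "p_integral p x \<Longrightarrow> p_integral p (- x)"
  using p_integral_mult[of "- 1" x] p_integral_of_int[of "- 1"] by simp

lemma p_integral_diff: "p_integral p x \<Longrightarrow> p_integral p y \<Longrightarrow> p_integral p (x - y)"
  using p_integral_add[of x "- y"] p_integral_uminus[of y] by simp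

lemma p_integral_power: "p_integral p x \<Longrightarrow> p_integral p (x ^ n)"
  by (induction n) (auto intro: p_integral_mult)

lemma p_integral_sum: "(\<And>k. k \<in> A \<Longrightarrow> p_integral p (f k)) \<Longrightarrow> p_integral p (sum f A)"
  by (induction A rule: infinite_finite_induct) (auto intro: p_integral_add)

text \<open>The modulus \<open>c\<close> is arbitrary, to allow 2p^2 besides powers of p.\<close>

lemma p_integral_wsum:
  assumes "\<And>k. 0 < k \<Longrightarrow> k < e \<Longrightarrow> p_integral p (f k / c)"
  shows "p_integral p (wsum f e / c)"
proof -
  have "wsum f e / c = (\<Sum>k\<in>{0<..<e}. f k / c * of_int (Legendre (int e - int k) 3))"
    by (simp add: wsum_def sum_divide_distrib)
  then show ?thesis
    using assms by (simp only:) (intro p_integral_sum p_integral_mult p_integral_of_int, simp)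
qed

text \<open>The multiplicity of p in k is less than a, so q/k retains a factor p.\<close>

lemma p_integral_prime_power_div:
  assumes "0 < k" "k < p ^ a"
  shows "p_integral p (of_nat (p ^ a) / (of_nat p * of_nat k))"
proof -
  define v where "v = multiplicity p k"
  obtain l where l: "k = p ^ v * l" "\<not> p dvd l"
    using multiplicity_decompose'[of k p] assms prime v_def by (metis not_prime_unit neq0_conv)
  have "p ^ v \<le> k"
    using l(1) assms(1) by (cases l) auto
  then have "v < a"
    using assms(2) prime prime_gt_1_nat power_less_imp_less_exp le_less_trans by blast
  then obtain c where "a = Suc (v + c)"
    using less_imp_Suc_add by blast
  then have "of_nat (p ^ a) / (of_nat p * of_nat k) = (of_int (int (p ^ c)) / of_int (int l) :: rat)"
    using l prime by (auto simp: field_simps power_add)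
  then show ?thesis
    unfolding p_integral_iff using l(2) by (metis int_dvd_int_iff)
qed

text \<open>Every factor is 1 modulo \<open>c\<close>. It serves for both c = p and c = 2p.\<close>

lemma p_integral_prod_minus_1:
  assumes "finite A" "p_integral p c" "c \<noteq> 0" "\<And>j. j \<in> A \<Longrightarrow> p_integral p (u j)"
  shows "p_integral p (((\<Prod>j\<in>A. 1 - c * u j) - 1) / c)"
  using assms(1,4)
proof (induction A rule: finite_induct)
  case (insert x A)
  define w where "w = ((\<Prod>j\<in>A. 1 - c * u j) - 1) / c"
  then have *: "(\<Prod>j\<in>A. 1 - c * u j) = 1 + c * w"
    using \<open>c \<noteq> 0\<close> by simp
  have "((\<Prod>j\<in>insert x A. 1 - c * u j) - 1) / c = w - u x - c * (u x * w)"
    unfolding prod.insert[OF insert.hyps] * using \<open>c \<noteq> 0\<close> by (simp add: field_simps)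
  moreover have "p_integral p w" "p_integral p (u x)"
    using insert by (auto simp: w_def)
  ultimately show ?case
    using assms(2) by (auto intro: p_integral_diff p_integral_mult)
qed simp

text \<open>To first order in \<open>c\<close> the products are 1 - 2cs and 1 - cs, where s is the
  sum of the \<open>u j\<close>; the combination cancels both the constant and the linear
  terms.\<close>

lemma p_integral_prod_double:
  assumes "finite A" "p_integral p c" "c \<noteq> 0" "\<And>j. j \<in> A \<Longrightarrow> p_integral p (u j)"
  shows "p_integral p (((\<Prod>j\<in>A. 1 - 2 * c * u j) - 2 * (\<Prod>j\<in>A. 1 - c * u j) + 1) / c\<^sup>2)"
  using assms(1,4)
proof (induction A rule: finite_induct)
  case (insert x A)
  define m where "m = ((\<Prod>j\<in>A. 1 - c * u j) - 1) / c"
  define w where "w = ((\<Prod>j\<in>A. 1 - 2 * c * u j) - 2 * (\<Prod>j\<in>A. 1 - c * u j) + 1) / c\<^sup>2"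
  have M: "(\<Prod>j\<in>A. 1 - c * u j) = 1 + c * m"
    using \<open>c \<noteq> 0\<close> by (simp add: m_def)
  have N: "(\<Prod>j\<in>A. 1 - 2 * c * u j) = c\<^sup>2 * w + 2 * (1 + c * m) - 1"
    using \<open>c \<noteq> 0\<close> by (simp add: w_def M)
  have "((\<Prod>j\<in>insert x A. 1 - 2 * c * u j) - 2 * (\<Prod>j\<in>insert x A. 1 - c * u j) + 1) / c\<^sup>2
     = w - 2 * u x * (c * w + m)"
    unfolding prod.insert[OF insert.hyps] M N using \<open>c \<noteq> 0\<close> by (simp add: field_simps power2_eq_square)
  moreover have "p_integral p w" "p_integral p (u x)"
    using insert by (auto simp: w_def)
  moreover have "p_integral p m"
    unfolding m_def by (rule p_integral_prod_minus_1) (use insert assms in auto)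
  ultimately show ?case
    using assms(2) by (auto intro!: p_integral_diff p_integral_add p_integral_mult)
qed simp


section \<open>Congruences for the weights and the decomposition of \<open>F\<close>\<close>

context
  fixes a :: nat
begin

abbreviation (input) "q \<equiv> p ^ a"

abbreviation (input) "lin k \<equiv> rat_of_nat q * ((- 1) ^ (k - 1) / rat_of_nat k)"

lemma F_eq_wsum:
  assumes "e \<le> q"
  shows "F p a e = wsum (\<lambda>k. of_nat ((2 * q) choose k) / 2) (q - e) + (- 1) ^ p * wsum lin e
    - of_nat p * of_bool (p = 3) * of_int (Legendre (int e) 3)"
proof -
  have "q > 0"
    using prime by (simp add: prime_gt_0_nat)
  then have "{0..q - 1} = {..<q}"
    by (metis Suc_pred' atLeast0AtMost lessThan_Suc_atMost)
  moreover have "of_nat q * S e = wsum lin e"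
    by (simp add: S_def wsum_def sum_distrib_left mult_ac)
  ultimately show ?thesis
    using sum_central_binomial_eq_wsum[OF assms]
      wsum_mult_left[of "1 / 2" "\<lambda>k. of_nat ((2 * q) choose k)" "q - e"]
    by (simp add: F_def field_simps)
qed

text \<open>Write \<open>lin k\<close> as pc and q/j as p times \<open>u j\<close>, with c and
  \<open>u j\<close> p-integral. The binomials become pc and 2pc times products of factors 1 - p
  \<open>u j\<close> and 1 - 2p \<open>u j\<close>, to which the product estimates apply. The latter
  factors are 1 modulo 2p, whence the modulus 2p^2.\<close>

lemma
  assumes "0 < k" "k < q"
  shows p_integral_lin: "p_integral p (lin k / of_nat p)"
    and p_integral_choose: "p_integral p ((of_nat (q choose k) - lin k) / of_nat p ^ 2)"
    and p_integral_double_choose: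
      "p_integral p ((of_nat ((2 * q) choose k) / 2 - lin k) / (2 * of_nat p ^ 2))"
    and p_integral_double_choose':
      "p_integral p ((of_nat ((2 * q) choose k) / 2 + lin k - 2 * of_nat (q choose k)) / of_nat p ^ 3)"
proof -
  define P where "P = rat_of_nat p"
  have P: "P \<noteq> 0" "p_integral p P" "p_integral p (2 * P)"
    using prime p_integral_of_nat[of "2 * p"] by (auto simp: P_def)
  define u where "u j = of_nat q / (P * of_nat j)" for j
  have u: "p_integral p (u j)" if "0 < j" "j < q" for j
    unfolding u_def P_def by (rule p_integral_prime_power_div) (use that in auto)
  then have u': "p_integral p (u j)" if "j \<in> {0<..<k}" for j
    using assms that by auto
  define c where "c = (- 1) ^ (k - 1) * u k"
  have c: "p_integral p c"
    unfolding c_def using u assms p_integral_of_int[of "- 1"]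
    by (intro p_integral_mult p_integral_power) auto
  have lin: "lin k = P * c"
    using P by (simp add: c_def u_def)
  have 1: "of_nat (q choose k) = P * c * (\<Prod>j\<in>{0<..<k}. 1 - P * u j)"
    unfolding of_nat_choose_eq_prod[OF assms(1)] lin using P by (simp add: u_def)
  have 2: "of_nat ((2 * q) choose k) = 2 * P * c * (\<Prod>j\<in>{0<..<k}. 1 - 2 * P * u j)"
    unfolding of_nat_choose_eq_prod[OF assms(1)] using P by (simp add: u_def c_def)
  show "p_integral p (lin k / of_nat p)"
    unfolding lin P_def[symmetric] using c P by simp
  have "(of_nat (q choose k) - lin k) / P ^ 2 = c * (((\<Prod>j\<in>{0<..<k}. 1 - P * u j) - 1) / P)"
    unfolding 1 lin using P by (simp add: field_simps power2_eq_square)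
  moreover have "p_integral p \<dots>"
    using u' c P by (intro p_integral_mult p_integral_prod_minus_1) auto
  ultimately show "p_integral p ((of_nat (q choose k) - lin k) / of_nat p ^ 2)"
    by (simp add: P_def)
  have "(of_nat ((2 * q) choose k) / 2 - lin k) / (2 * P ^ 2)
      = c * (((\<Prod>j\<in>{0<..<k}. 1 - 2 * P * u j) - 1) / (2 * P))"
    unfolding 2 lin using P by (simp add: field_simps power2_eq_square)
  moreover have "p_integral p \<dots>"
    using u' c P by (intro p_integral_mult p_integral_prod_minus_1) auto
  ultimately show "p_integral p ((of_nat ((2 * q) choose k) / 2 - lin k) / (2 * of_nat p ^ 2))"
    by (simp add: P_def)
  have "(of_nat ((2 * q) choose k) / 2 + lin k - 2 * of_nat (q choose k)) / P ^ 3
      = c * (((\<Prod>j\<in>{0<..<k}. 1 - 2 * P * u j) - 2 * (\<Prod>j\<in>{0<..<k}. 1 - P * u j) + 1) / P\<^sup>2)"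
    unfolding 1 2 lin using P by (simp add: field_simps power2_eq_square power3_eq_cube)
  moreover have "p_integral p \<dots>"
    using u' c P by (intro p_integral_mult p_integral_prod_double) auto
  ultimately show "p_integral p ((of_nat ((2 * q) choose k) / 2 + lin k - 2 * of_nat (q choose k)) / of_nat p ^ 3)"
    by (simp add: P_def)
qed

section \<open>The two congruences for \<open>F\<close>, by the parity of p\<close>

lemma F_congruences:
  assumes "a > 0" "d \<le> q"
  shows "rat_cong p 2 (F p a d) (of_nat p * of_bool (p = 2 \<and> \<not> 3 dvd (- 1) ^ a + int d))
    \<and> rat_cong p 3 (F p a (q - d)) (F p a d)"
proof -
  define P where "P = rat_of_nat p"
  have P: "P \<noteq> 0"
    using prime by (auto simp: P_def)
  have q: "q > 0"
    using prime by (simp add: prime_gt_0_nat)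
  define B where "B = wsum (\<lambda>k. of_nat (q choose k))"
  define D where "D = wsum (\<lambda>k. of_nat ((2 * q) choose k) / 2)"
  define L where "L = wsum lin"
  define t where "t = of_nat p * of_bool (p = 3) * rat_of_int (Legendre (int d) 3)"
  define t' where "t' = of_nat p * of_bool (p = 3) * rat_of_int (Legendre (int (q - d)) 3)"
  have F: "F p a d = D (q - d) + (- 1) ^ p * L d - t"
      "F p a (q - d) = D d + (- 1) ^ p * L (q - d) - t'"
    using F_eq_wsum[of d] F_eq_wsum[of "q - d"] assms(2)
    by (simp_all add: D_def L_def t_def t'_def)
  have BL: "p_integral p ((B e - L e) / P ^ 2)" if "e \<le> q" for e
    unfolding B_def L_def P_def wsum_diff[symmetric]
    by (rule p_integral_wsum, rule p_integral_choose) (use that in auto)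
  have DL': "p_integral p ((D e - L e) / (2 * P ^ 2))" if "e \<le> q" for e
    unfolding D_def L_def P_def wsum_diff[symmetric]
    by (rule p_integral_wsum, rule p_integral_double_choose) (use that in auto)
  have DL: "p_integral p ((D e - L e) / P ^ 2)" if "e \<le> q" for e
  proof -
    have "(D e - L e) / P ^ 2 = 2 * ((D e - L e) / (2 * P ^ 2))"
      using P by (simp add: field_simps)
    then show ?thesis
      using DL'[OF that] by (simp only:) (intro p_integral_mult p_integral_numeral)
  qed
  have DLB: "p_integral p ((D e + L e - 2 * B e) / P ^ 3)" if "e \<le> q" for e
    unfolding B_def D_def L_def P_def wsum_diff[symmetric] wsum_add[symmetric] wsum_mult_left[symmetric]
    by (rule p_integral_wsum, rule p_integral_double_choose') (use that in auto)
  have B: "B d - B (q - d) = of_int ((- 1) ^ q * Legendre (int d + int q) 3 - Legendre (int d) 3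
        - Legendre (int d - int q) 3)"
    unfolding B_def using assms(2) q by (rule wsum_binomial_diff)
  note sum3 = Legendre_3_add_residues[of "int q" "int d"]
  show ?thesis
  proof (cases "p = 2")
    case True
    then have P2: "P = 2" and sgn: "(- 1 :: rat) ^ p = 1" "(- 1 :: int) ^ q = 1" and "t = 0" "t' = 0"
      using assms(1) by (auto simp: P_def t_def t'_def)
    \<comment> \<open>As 2 is -1 modulo 3, this is where the (-1)^a of the statement comes
      from.\<close>
    have "[int q = (- 1) ^ a] (mod 3)"
      using cong_pow[of 2 "- 1 :: int" 3 a] by (simp add: True cong_def)
    then have residue: "(int d + int q) mod 3 = ((- 1) ^ a + int d) mod 3"
      by (metis add.commute cong_add_lcancel cong_def)
    have "\<not> 3 dvd int q"
      using prime_dvd_power[of "3 :: int" 2 a] by (auto simp: True)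
    with sum3 have "B d - B (q - d) = of_int (2 * Legendre (int d + int q) 3)"
      unfolding B sgn by (intro arg_cong[where f = of_int]) simp
    also have "p_integral p ((\<dots> - P * of_bool (\<not> 3 dvd (- 1) ^ a + int d)) / P ^ 2)"
    proof -
      \<comment> \<open>The symbol and its Iverson bracket agree modulo 2, so their doubles agree
        modulo 4.\<close>
      have "Legendre x 3 = of_bool (\<not> 3 dvd x) \<or> Legendre x 3 = of_bool (\<not> 3 dvd x) - 2" for x
        by (auto simp: Legendre_3 dvd_eq_mod_eq_0)
      from this[of "(- 1) ^ a + int d"] show ?thesis
        unfolding Legendre_3_cong[OF residue] P2
        using p_integral_of_int[of "- 1"] by (elim disjE) (simp_all add: right_diff_distrib)
    qed
    finally have main: "p_integral p
        ((B d - B (q - d) - P * of_bool (\<not> 3 dvd (- 1) ^ a + int d)) / P ^ 2)" .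
    \<comment> \<open>With p = 2 the decomposition of \<open>F p a d\<close> leaves 2B(q - d), so
      B(q - d) must be divisible by p; it inherits this from \<open>L\<close>.\<close>
    have "p_integral p (L (q - d) / P)"
      unfolding L_def P_def by (rule p_integral_wsum, rule p_integral_lin) auto
    then have "p_integral p (P * ((B (q - d) - L (q - d)) / P ^ 2) + L (q - d) / P)"
      using BL[of "q - d"] by (intro p_integral_add p_integral_mult) (auto simp: P_def)
    then have BP: "p_integral p (B (q - d) / P)"
      using P by (simp add: field_simps power2_eq_square)
    have "(F p a d - P * of_bool (\<not> 3 dvd (- 1) ^ a + int d)) / P ^ 2
      = (D (q - d) - L (q - d)) / P ^ 2 - (B d - L d) / P ^ 2 - (B (q - d) - L (q - d)) / P ^ 2
        + B (q - d) / P + (B d - B (q - d) - P * of_bool (\<not> 3 dvd (- 1) ^ a + int d)) / P ^ 2"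
      unfolding F sgn \<open>t = 0\<close> P2 by (simp add: field_simps)
    moreover have "p_integral p \<dots>"
      using main BP DL BL assms(2) by (intro p_integral_add p_integral_diff) auto
    ultimately have "p_integral p ((F p a d - P * of_bool (\<not> 3 dvd (- 1) ^ a + int d)) / P ^ 2)"
      by (simp only:)
    then have "rat_cong p 2 (F p a d) (of_nat p * of_bool (p = 2 \<and> \<not> 3 dvd (- 1) ^ a + int d))"
      unfolding rat_cong_iff_p_integral by (simp add: P_def True)
    \<comment> \<open>Here \<open>P ^ 3\<close> is \<open>2 * P ^ 2\<close>, so the sharper estimate
      \<open>DL'\<close> suffices.\<close>
    moreover have "(F p a (q - d) - F p a d) / P ^ 3
      = (D d - L d) / (2 * P ^ 2) - (D (q - d) - L (q - d)) / (2 * P ^ 2)"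
      unfolding F sgn \<open>t = 0\<close> \<open>t' = 0\<close> P2 by (simp add: field_simps)
    then have "rat_cong p 3 (F p a (q - d)) (F p a d)"
      using DL' assms(2) by (simp add: rat_cong_iff_p_integral P_def p_integral_diff)
    ultimately show ?thesis ..
  next
    case False
    then have "odd p"
      using prime primes_dvd_imp_eq two_is_prime_nat by blast
    then have sgn: "(- 1 :: rat) ^ p = - 1" "(- 1 :: int) ^ q = - 1"
      by simp_all
    \<comment> \<open>Now q is odd, so the difference is minus a sum of three symbols: zero for p
      \<noteq> 3, and minus three equal symbols for p = 3. This explains the correction term of
      \<open>F\<close>.\<close>
    have Bt: "B d - B (q - d) = - t \<and> t' = - t"
    proof (cases "p = 3")
      case True
      have "int q mod 3 = 0"
        using assms(1) by (simp add: True)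
      then have residues: "(int d + int q) mod 3 = int d mod 3" "(int d - int q) mod 3 = int d mod 3"
          "int (q - d) mod 3 = (- int d) mod 3"
        using assms(2) by (auto simp: of_nat_diff) presburger+
      have "Legendre (int d + int q) 3 = Legendre (int d) 3"
          "Legendre (int d - int q) 3 = Legendre (int d) 3"
          "Legendre (int (q - d)) 3 = - Legendre (int d) 3"
        by (simp_all only: residues[THEN Legendre_3_cong] Legendre_3_uminus)
      then show ?thesis
        unfolding B sgn t_def t'_def using True by simp
    next
      case False
      then have "\<not> 3 dvd q"
        using prime prime_dvd_power[of 3 p a] primes_dvd_imp_eq[of 3 p] by auto
      then have "\<not> 3 dvd int q"
        by presburger
      with sum3 have "- 1 * Legendre (int d + int q) 3 - Legendre (int d) 3 - Legendre (int d - int q) 3 = 0"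
        by simp
      then show ?thesis
        unfolding B sgn t_def t'_def using False by simp
    qed
    have "F p a d / P ^ 2 = (D (q - d) - L (q - d)) / P ^ 2 + (B d - L d) / P ^ 2
        - (B (q - d) - L (q - d)) / P ^ 2"
    proof -
      have "F p a d = (D (q - d) - L (q - d)) + (B d - L d) - (B (q - d) - L (q - d))"
        unfolding F sgn using Bt by (simp add: algebra_simps)
      then show ?thesis
        by (simp add: add_divide_distrib diff_divide_distrib)
    qed
    moreover have "p_integral p \<dots>"
      using DL BL assms(2) by (intro p_integral_add p_integral_diff) auto
    ultimately have "rat_cong p 2 (F p a d) (of_nat p * of_bool (p = 2 \<and> \<not> 3 dvd (- 1) ^ a + int d))"
      using False by (simp add: rat_cong_iff_p_integral P_def)
    moreover have "(F p a (q - d) - F p a d) / P ^ 3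
        = (D d + L d - 2 * B d) / P ^ 3 - (D (q - d) + L (q - d) - 2 * B (q - d)) / P ^ 3"
    proof -
      \<comment> \<open>The corrections \<open>t\<close> and \<open>t'\<close> together contribute
        2t, which is -2(B(d) - B(q - d)).\<close>
      have "F p a (q - d) - F p a d = (D d + L d - 2 * B d) - (D (q - d) + L (q - d) - 2 * B (q - d))"
        unfolding F sgn using Bt by (simp add: algebra_simps)
      then show ?thesis
        by (simp add: diff_divide_distrib)
    qed
    then have "rat_cong p 3 (F p a (q - d)) (F p a d)"
      using DLB assms(2) by (simp add: rat_cong_iff_p_integral P_def p_integral_diff)
    ultimately show ?thesis ..
  qed
qed

end

end

theorem theorem1p1:
  fixes p a d :: nat
  assumes "prime p" and "a > 0" and "d \<in> {0..p ^ a}"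
  shows "rat_cong p 2 (F p a d) (of_nat p * of_bool (p = 2 \<and> \<not> 3 dvd (- 1) ^ a + int d))
       \<and> rat_cong p 3 (F p a (p ^ a - d)) (F p a d)"
  using assms by (intro F_congruences) auto

end
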